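(* Let $q=2^r$. For a finite group $G$ of matrices over $\mathbb{F}_q$ with elements listed as $g_1,\ldots,g_N$, and $a\in\mathbb{F}_q$, put $c(a)=(tr(a\,\mathrm{Tr}\,g_1),\ldots,tr(a\,\mathrm{Tr}\,g_N))\in\mathbb{F}_2^N$; these vectors lie in the dual code $C(G)^\perp\subseteq\mathbb{F}_2^N$. Then: (a) if $r\ge3$, the map $\mathbb{F}_q\to C(G)^\perp$, $a\mapsto c(a)$, is an $\mathbb{F}_2$-linear isomorphism for $G=SO^+(2,q)$ and for $G=O^+(2,q)$; (b) for every $r\ge1$, the map $\mathbb{F}_q\to C(SO^+(4,q))^\perp$, $a\mapsto c(a)$, is an $\mathbb{F}_2$-linear isomorphism.
   Context: $tr(x)=x+x^2+\cdots+x^{2^{r-1}}$ is the absolute trace $\mathbb{F}_q\to\mathbb{F}_2$; $\mathrm{Tr}$ is the matrix trace. The binary code $C(G)=\{u\in\mathbb{F}_2^N:\ \sum_{j=1}^N u_j\,\mathrm{Tr}(g_j)=0\text{ in }\mathbb{F}_q\}$ and $C(G)^\perp$ is its dual with respect to the standard inner product on $\mathbb{F}_2^N$. On column vectors $x\in\mathbb{F}_q^{2n}$ let $\theta^+(x)=\sum_{i=1}^n x_ix_{n+i}$; $O^+(2n,q)$ is the group of $g\in GL(2n,q)$ preserving $\theta^+$; equivalently, writing $g=\begin{bmatrix}A&B\\C&D\end{bmatrix}$ with $n\times n$ blocks, ${}^tAC,{}^tBD$ are alternating (symmetric with zero diagonal) and ${}^tAD+{}^tCB=1_n$. The map $\delta^+(g)=\mathrm{Tr}(B\,{}^tC)$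 is a surjective homomorphism $O^+(2n,q)\to\mathbb{F}_2$ and $SO^+(2n,q)=\ker\delta^+$. *)

theory Defs
  imports
    "Jordan_Normal_Form.Matrix"
    "HOL-Algebra.Group"
    "HOL-Computational_Algebra.Primes"
    "HOL-Library.Cardinality"
    "HOL-Library.Z2"
begin

text \<open>
  \<open>\<F>\<^sub>q\<close> is an arbitrary finite field type \<open>'a\<close> with \<open>CARD('a) = 2 ^ r\<close>. The field \<open>\<F>\<^sub>2\<close> is
  \<^typ>\<open>bit\<close>, embedded in \<open>\<F>\<^sub>q\<close> by \<open>of_bit\<close>, an abbreviation that is
  printed as \<open>of_bool (odd b)\<close>. Coordinates are numbered from 0.
\<close>

text \<open>
  The defining sum is computed in \<open>\<F>\<^sub>q\<close> and lies in the prime field; \<open>abs_trace\<close> is the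
  corresponding element of \<^typ>\<open>bit\<close>, see \<open>of_bit_abs_trace\<close> below.
\<close>

definition abs_trace :: "nat \<Rightarrow> 'a::field \<Rightarrow> bit" where
  "abs_trace r x = (THE b. of_bit b = (\<Sum>i<r. x ^ (2 ^ i)))"

lemma of_bit_abs_trace:
  fixes x :: "'a :: finite_field"
  assumes card: "CARD('a) = 2 ^ r"
  shows "of_bit (abs_trace r x) = (\<Sum>i<r. x ^ (2 ^ i))"
proof -
  have r: "r \<noteq> 0"
  proof
    assume "r = 0"
    then have "card (UNIV :: 'a set) = 1" using card by simp
    moreover have "card {0, 1 :: 'a} \<le> card (UNIV :: 'a set)" by (rule card_mono) auto
    ultimately show False by simp
  qed
  have "(- 1 :: 'a) ^ CARD('a) = - 1" by (rule finite_field_power_card_eq_same)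
  then have "(1 :: 'a) = - 1" using card r by simp
  then have two: "(1 :: 'a) + 1 = 0" by (metis add.right_inverse)
  have dbl: "y + y = 0" for y :: 'a
    using two by simp
  have frob: "(\<Sum>i<n. x ^ (2 ^ i)) ^ 2 = (\<Sum>i<n. x ^ (2 ^ Suc i))" for n
    by (induction n) (simp_all add: power2_sum mult_2 dbl power_mult [symmetric] mult.commute)
  define s where "s = (\<Sum>i<r. x ^ (2 ^ i))"
  have "s ^ 2 + x = (\<Sum>i<Suc r. x ^ (2 ^ i))"
    unfolding s_def frob by (subst sum.lessThan_Suc_shift) simp
  also have "\<dots> = s + x ^ CARD('a)" by (simp add: s_def card)
  also have "\<dots> = s + x" by (simp add: finite_field_power_card_eq_same)
  finally have "s * s = s * 1" by (simp add: power2_eq_square)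
  then have "s = 0 \<or> s = 1" by (metis mult_left_cancel)
  then obtain b where b: "of_bit b = s"
    by (metis even_zero odd_one of_bool_eq(1) of_bool_eq(2))
  have "abs_trace r x = b"
    unfolding abs_trace_def s_def [symmetric]
  proof (rule the_equality)
    fix b' :: bit
    assume "of_bit b' = s"
    with b show "b' = b" by (cases b; cases b') auto
  qed (fact b)
  with b show ?thesis by (simp add: s_def)
qed

definition mat_trace :: "'a::comm_monoid_add mat \<Rightarrow> 'a" where
  "mat_trace A = (\<Sum>i<dim_row A. A $$ (i, i))"

definition GL :: "nat \<Rightarrow> 'a::field mat monoid" where
  "GL m = units_of (ring_mat TYPE('a) m ())"

definition theta_plus :: "nat \<Rightarrow> 'a::field vec \<Rightarrow> 'a" where
  "theta_plus n x = (\<Sum>i<n. x $ i * x $ (n + i))"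

definition O_plus :: "nat \<Rightarrow> 'a::field mat set" where
  "O_plus n = {g \<in> carrier (GL (2 * n)).
     \<forall>x \<in> carrier_vec (2 * n). theta_plus n (g *\<^sub>v x) = theta_plus n x}"

definition delta_plus :: "nat \<Rightarrow> 'a::field mat \<Rightarrow> 'a" where
  "delta_plus n g = (case split_block g n n of (A, B, C, D) \<Rightarrow> mat_trace (B * transpose_mat C))"

definition SO_plus :: "nat \<Rightarrow> 'a::field mat set" where
  "SO_plus n = {g \<in> O_plus n. delta_plus n g = 0}"

text \<open>
  A listing of \<open>G\<close> is a list \<open>gs\<close> of its elements without repetition; the code length is
  \<open>N = length gs\<close>.
\<close>

definition lists_elements :: "'b list \<Rightarrow> 'b set \<Rightarrow> bool" where
  "lists_elements gs G \<longleftrightarrow> distinct gs \<and> set gs = G"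

definition trace_code :: "'a::field mat list \<Rightarrow> bit vec set" where
  "trace_code gs = {u \<in> carrier_vec (length gs).
     (\<Sum>j<length gs. of_bit (u $ j) * mat_trace (gs ! j)) = 0}"

definition dual_code :: "nat \<Rightarrow> bit vec set \<Rightarrow> bit vec set" where
  "dual_code N C = {v \<in> carrier_vec N. \<forall>u\<in>C. u \<bullet> v = 0}"

definition codeword :: "nat \<Rightarrow> 'a::field mat list \<Rightarrow> 'a \<Rightarrow> bit vec" where
  "codeword r gs a = vec (length gs) (\<lambda>j. abs_trace r (a * mat_trace (gs ! j)))"

definition F2_linear_iso :: "('a::field \<Rightarrow> bit vec) \<Rightarrow> bit vec set \<Rightarrow> bool" where
  "F2_linear_iso f V \<longleftrightarrow>
     bij_betw f UNIV V \<and>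
     (\<forall>a b. f (a + b) = f a + f b) \<and>
     (\<forall>k a. f (of_bit k * a) = k \<cdot>\<^sub>v f a)"

end

theory Submission
  imports Defs "HOL-Computational_Algebra.Polynomial"
begin

text \<open>
  That every word of the dual code is some \<open>c(a)\<close> holds for every list of matrices: if \<open>v\<close> is
  orthogonal to the code but is no \<open>c(a)\<close>, then \<open>\<Sum>\<^sub>u (-1)\<^bsup>u\<cdot>(v + c(a))\<^esup> = 0\<close> for all \<open>a\<close>, whereas
  summing over \<open>a\<close> first leaves \<open>q\<close> times the size of the code.

  Injectivity means that \<open>tr(a Tr g) = 0\<close> for all \<open>g\<close> forces \<open>a = 0\<close>. For \<open>SO\<^sup>+(2,q)\<close> the traces
  are the elements \<open>t + t\<^sup>-\<^sup>1\<close>; then \<open>\<Sum>\<^sub>i a\<^bsup>2^i\<^esup> (t\<^bsup>2^i\<^esup> + t\<^bsup>q-1-2^i\<^esup>)\<close> is a polynomial of degree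
  at most \<open>q - 2\<close> with \<open>q - 1\<close> roots, and for \<open>r \<ge> 3\<close> its coefficient at \<open>t\<close> is \<open>a\<close>. For
  \<open>SO\<^sup>+(4,q)\<close>, every field element is the trace of some \<open>g\<close>.
\<close>

section \<open>Characteristic two and additivity of the absolute trace\<close>

text \<open>Raising to the power q fixes \<open>- 1\<close>, and q is even because a field has at
  least two elements; hence \<open>1 = - 1\<close>.\<close>

lemma char2_double:
  fixes y :: "'a :: finite_field"
  assumes card: "CARD('a) = 2 ^ r"
  shows "y + y = 0"
proof -
  have r: "r \<noteq> 0"
  proof
    assume "r = 0"
    then have "card (UNIV :: 'a set) = 1" using card by simp
    moreover have "card {0, 1 :: 'a} \<le> card (UNIV :: 'a set)" by (rule card_mono) auto
    ultimately show False by simp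
  qed
  have "(- 1 :: 'a) ^ CARD('a) = - 1" by (rule finite_field_power_card_eq_same)
  then have "(1 :: 'a) = - 1" using card r by simp
  then have "(1 :: 'a) + 1 = 0" by (metis add.right_inverse)
  then show ?thesis by (metis distrib_right mult_1 mult_zero_left)
qed

lemma of_bit_inject: "(of_bit b :: 'a :: field) = of_bit c \<longleftrightarrow> b = c"
  by (cases b; cases c) auto

lemma of_bit_add:
  fixes b c :: bit
  assumes "CARD('a :: finite_field) = 2 ^ r"
  shows "(of_bit (b + c) :: 'a) = of_bit b + of_bit c"
  using char2_double[OF assms, of "1 :: 'a"] by (cases b; cases c) auto

lemma frobenius_add:
  fixes x y :: "'a :: finite_field"
  assumes "CARD('a) = 2 ^ r"
  shows "(x + y) ^ (2 ^ i) = x ^ (2 ^ i) + y ^ (2 ^ i)"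
proof (induction i)
  case (Suc i)
  have "(x + y) ^ (2 ^ Suc i) = ((x + y) ^ (2 ^ i)) ^ 2"
    by (simp add: power_mult[symmetric] mult.commute)
  also have "\<dots> = (x ^ (2 ^ i)) ^ 2 + (y ^ (2 ^ i)) ^ 2"
    unfolding Suc power2_sum mult.assoc mult_2 char2_double[OF assms]
    by (simp only: mult_zero_left add_0_right)
  finally show ?case by (simp add: power_mult[symmetric] mult.commute)
qed simp

lemma abs_trace_add:
  fixes x y :: "'a :: finite_field"
  assumes "CARD('a) = 2 ^ r"
  shows "abs_trace r (x + y) = abs_trace r x + abs_trace r y"
proof -
  \<comment> \<open>The equation is compared in the big field, where the trace is an explicit sum of
    Frobenius powers, and pulled back along the embedding.\<close>
  have "(of_bit (abs_trace r (x + y)) :: 'a) = of_bit (abs_trace r x + abs_trace r y)"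
    unfolding of_bit_add[OF assms] of_bit_abs_trace[OF assms]
    by (simp add: frobenius_add[OF assms] sum.distrib)
  then show ?thesis by (simp only: of_bit_inject)
qed

lemma abs_trace_0:
  assumes "CARD('a :: finite_field) = 2 ^ r"
  shows "abs_trace r (0 :: 'a) = 0"
  using abs_trace_add[OF assms, of 0 0] by simp

lemma abs_trace_of_bit_mult:
  fixes x :: "'a :: finite_field"
  assumes "CARD('a) = 2 ^ r"
  shows "abs_trace r (of_bit b * x) = b * abs_trace r x"
  by (cases b) (simp_all add: abs_trace_0[OF assms])

lemma abs_trace_sum:
  fixes f :: "'b \<Rightarrow> 'a :: finite_field"
  assumes "CARD('a) = 2 ^ r"
  shows "abs_trace r (sum f A) = (\<Sum>x\<in>A. abs_trace r (f x))"
  by (induction A rule: infinite_finite_induct)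
    (simp_all add: abs_trace_0[OF assms] abs_trace_add[OF assms])

section \<open>Nondegeneracy of the trace by counting roots\<close>

lemma poly_eq_0_if_many_roots:
  fixes p :: "'a :: idom poly"
  assumes "finite S" "\<And>x. x \<in> S \<Longrightarrow> poly p x = 0" "degree p < card S"
  shows "p = 0"
proof (rule ccontr)
  assume "p \<noteq> 0"
  then have "finite {x. poly p x = 0}" by (rule poly_roots_finite)
  then have "card S \<le> card {x. poly p x = 0}"
    by (rule card_mono) (use assms(2) in auto)
  also have "\<dots> \<le> degree p" using \<open>p \<noteq> 0\<close> by (rule card_poly_roots_bound)
  finally show False using assms(3) by simp
qed

text \<open>As a function of x, the trace of \<open>a * x\<close> is a polynomial of degree below q
  with linear coefficient \<open>a\<close>; if it vanishes at all q points, it is the zero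
  polynomial.\<close>

lemma abs_trace_nondegenerate:
  fixes a :: "'a :: finite_field"
  assumes card: "CARD('a) = 2 ^ r" and r: "1 \<le> r"
    and zero: "\<And>x. abs_trace r (a * x) = 0"
  shows "a = 0"
proof -
  define p where "p = (\<Sum>i<r. monom (a ^ (2 ^ i)) (2 ^ i))"
  have "p = 0"
  proof (rule poly_eq_0_if_many_roots)
    show "poly p x = 0" for x
      using of_bit_abs_trace[OF card, of "a * x"]
      by (simp add: p_def poly_sum poly_monom zero power_mult_distrib)
    have "degree p \<le> 2 ^ r - 1"
      unfolding p_def
    proof (rule degree_sum_le)
      fix i assume "i \<in> {..<r}"
      then have "(2 :: nat) ^ i < 2 ^ r" by simp
      then show "degree (monom (a ^ 2 ^ i) (2 ^ i)) \<le> 2 ^ r - 1"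
        by (intro order.trans[OF degree_monom_le]) linarith
    qed simp
    then show "degree p < card (UNIV :: 'a set)"
      using card by (simp add: order.strict_trans1)
  qed simp
  have "coeff p 1 = (\<Sum>i<r. if i = 0 then a else 0)"
    unfolding p_def coeff_sum by (intro sum.cong refl) auto
  also have "\<dots> = a" using r by simp
  finally show ?thesis using \<open>p = 0\<close> by simp
qed

lemma abs_trace_inverse_nondegenerate:
  fixes a :: "'a :: finite_field"
  assumes card: "CARD('a) = 2 ^ r" and r: "3 \<le> r"
    and zero: "\<And>t. t \<noteq> 0 \<Longrightarrow> abs_trace r (a * (t + inverse t)) = 0"
  shows "a = 0"
proof -
  \<comment> \<open>For nonzero \<open>t\<close>, \<open>t ^ (q - 1) = 1\<close>, so
    \<open>t ^ e i\<close> replaces the negative power of \<open>t\<close> and keeps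
    \<open>p\<close> a polynomial.\<close>
  define e where "e i = (2 :: nat) ^ r - 1 - 2 ^ i" for i
  have pow_le: "(2 :: nat) ^ i \<le> 2 ^ (r - 1)" if "i < r" for i
    using that by (intro power_increasing) auto
  have half: "(2 :: nat) ^ r = 2 * 2 ^ (r - 1)"
    using r by (metis Suc_diff_1 less_le_trans power_Suc zero_less_numeral)
  have four: "(4 :: nat) \<le> 2 ^ (r - 1)"
    using power_increasing[of 2 "r - 1" "2 :: nat"] r by simp
  define p where "p = (\<Sum>i<r. monom (a ^ (2 ^ i)) (2 ^ i) + monom (a ^ (2 ^ i)) (e i))"
  have "p = 0"
  proof (rule poly_eq_0_if_many_roots)
    fix t :: 'a
    assume "t \<in> UNIV - {0}"
    then have t: "t \<noteq> 0" by simp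
    have "t * t ^ (2 ^ r - 1) = t * 1"
      using finite_field_power_card_eq_same[of t] card
      by (metis Suc_diff_1 mult_1_right pos2 power_Suc zero_less_power)
    then have fermat: "t ^ (2 ^ r - 1) = 1" using t by simp
    have inv: "inverse t ^ (2 ^ i) = t ^ e i" if "i < r" for i
    proof -
      have "t ^ (2 ^ i) * t ^ e i = 1"
        unfolding power_add[symmetric] e_def using that fermat
        by (simp add: Suc_leI le_diff_conv2)
      then show ?thesis by (simp add: power_inverse inverse_unique)
    qed
    have "poly p t = (\<Sum>i<r. (a * (t + inverse t)) ^ (2 ^ i))"
      unfolding p_def poly_sum
      by (intro sum.cong refl)
        (simp add: poly_monom inv frobenius_add[OF card] power_mult_distrib distrib_left)
    then show "poly p t = 0"
      using of_bit_abs_trace[OF card, of "a * (t + inverse t)"] zero[OF t] by simp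
  next
    \<comment> \<open>The largest exponent is \<open>e 0 = q - 2\<close>, one less than the number
      of nonzero field elements.\<close>
    have "degree p \<le> 2 ^ r - 2"
      unfolding p_def
    proof (rule degree_sum_le)
      fix i assume "i \<in> {..<r}"
      then have "2 ^ i \<le> (2 :: nat) ^ r - 2" "e i \<le> 2 ^ r - 2"
        using pow_le[of i] half four one_le_power[of "2 :: nat" i]
        unfolding e_def lessThan_iff by linarith+
      then show "degree (monom (a ^ 2 ^ i) (2 ^ i) + monom (a ^ 2 ^ i) (e i)) \<le> 2 ^ r - 2"
        by (intro degree_add_le) (auto intro: order.trans[OF degree_monom_le])
    qed simp
    then show "degree p < card (UNIV - {0 :: 'a})"
      using card half four by (simp add: card_Diff_singleton)
  qed simp
  \<comment> \<open>Here \<open>r \<ge> 3\<close> enters: \<open>e i\<close> is at least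
    \<open>2 ^ (r - 1) - 1\<close>, hence at least 3. For \<open>r = 2\<close>,
    \<open>e 1 = 1\<close> would spoil the linear coefficient.\<close>
  have "e i \<noteq> 1" if "i < r" for i
    using pow_le[OF that] half four unfolding e_def by linarith
  then have "coeff p 1 = (\<Sum>i<r. if i = 0 then a else 0)"
    unfolding p_def coeff_sum by (intro sum.cong refl) auto
  also have "\<dots> = a" using r by simp
  finally show ?thesis using \<open>p = 0\<close> by simp
qed

section \<open>Sums of additive characters\<close>

text \<open>The nontrivial additive character of the two-element field, with integer values so that
  sums can be compared by size.\<close>

definition bit_sign :: "bit \<Rightarrow> int" where
  "bit_sign b = (if b = 0 then 1 else - 1)"

lemma bit_sign_add: "bit_sign (b + c) = bit_sign b * bit_sign c"
  by (cases b; cases c) (simp_all add: bit_sign_def)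

text \<open>Reindexing along \<open>t\<close> negates every term, so the sum equals its own
  negative.\<close>

lemma sum_bit_sign_eq_0:
  assumes "bij_betw t S S" and "\<And>u. u \<in> S \<Longrightarrow> f (t u) = f u + 1"
  shows "(\<Sum>u\<in>S. bit_sign (f u)) = 0"
proof -
  have "(\<Sum>u\<in>S. bit_sign (f u)) = (\<Sum>u\<in>S. bit_sign (f (t u)))"
    by (rule sum.reindex_bij_betw[OF assms(1), symmetric])
  also have "\<dots> = - (\<Sum>u\<in>S. bit_sign (f u))"
    unfolding sum_negf[symmetric]
    by (intro sum.cong refl) (simp only: assms(2) bit_sign_add, simp add: bit_sign_def)
  finally show ?thesis by simp
qed

text \<open>For nonzero \<open>y\<close>, nondegeneracy gives an \<open>x\<close> with
  \<open>x * y\<close> of trace 1; translation by \<open>x\<close> flips every sign.\<close>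

lemma sum_bit_sign_abs_trace:
  fixes y :: "'a :: finite_field"
  assumes card: "CARD('a) = 2 ^ r" and r: "1 \<le> r"
  shows "(\<Sum>a\<in>UNIV. bit_sign (abs_trace r (a * y))) = (if y = 0 then 2 ^ r else 0)"
proof (cases "y = 0")
  case True
  then show ?thesis by (simp add: abs_trace_0[OF card] bit_sign_def card)
next
  case False
  then obtain x where "abs_trace r (y * x) \<noteq> 0"
    using abs_trace_nondegenerate[OF card r, of y] by blast
  then have "abs_trace r (x * y) = 1" by (simp add: mult.commute)
  moreover have "bij (\<lambda>a. a + x)"
    by (rule bij_betw_byWitness[where f' = "\<lambda>a. a - x"]) auto
  ultimately show ?thesis
    using False sum_bit_sign_eq_0[of "\<lambda>a. a + x" UNIV "\<lambda>a. abs_trace r (a * y)"]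
    by (simp add: distrib_right abs_trace_add[OF card])
qed

section \<open>Codewords and the dual code\<close>

lemma codeword_carrier: "codeword r gs a \<in> carrier_vec (length gs)"
  by (simp add: codeword_def)

text \<open>Linearity moves the trace outside the sum, so the pairing depends on \<open>u\<close>
  only through the sum whose vanishing defines the code.\<close>

lemma scalar_prod_codeword:
  fixes a :: "'a :: finite_field"
  assumes card: "CARD('a) = 2 ^ r"
  shows "u \<bullet> codeword r gs a =
    abs_trace r (a * (\<Sum>j<length gs. of_bit (u $ j) * mat_trace (gs ! j)))"
proof -
  have "u \<bullet> codeword r gs a =
      (\<Sum>j<length gs. u $ j * abs_trace r (a * mat_trace (gs ! j)))"
    unfolding scalar_prod_def codeword_def dim_vec atLeast0LessThan
    by (intro sum.cong refl arg_cong2[where f = times] index_vec) simp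
  also have "\<dots> = (\<Sum>j<length gs. abs_trace r (of_bit (u $ j) * (a * mat_trace (gs ! j))))"
    by (simp only: abs_trace_of_bit_mult[OF card])
  also have "\<dots> = abs_trace r (a * (\<Sum>j<length gs. of_bit (u $ j) * mat_trace (gs ! j)))"
    by (simp only: abs_trace_sum[OF card] sum_distrib_left mult.left_commute)
  finally show ?thesis .
qed

lemma codeword_in_dual_code:
  fixes a :: "'a :: finite_field"
  assumes "CARD('a) = 2 ^ r"
  shows "codeword r gs a \<in> dual_code (length gs) (trace_code gs)"
  by (auto simp: dual_code_def codeword_carrier scalar_prod_codeword[OF assms]
      trace_code_def abs_trace_0[OF assms])

lemma finite_carrier_vec_bit: "finite (carrier_vec N :: bit vec set)"
proof (rule finite_subset)
  show "carrier_vec N \<subseteq> vec_of_list ` {xs :: bit list. set xs \<subseteq> UNIV \<and> length xs = N}"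
  proof
    fix u :: "bit vec" assume "u \<in> carrier_vec N"
    then show "u \<in> vec_of_list ` {xs. set xs \<subseteq> UNIV \<and> length xs = N}"
      by (intro image_eqI[of _ _ "list_of_vec u"]) (auto simp: vec_list)
  qed
  have "finite (UNIV :: bit set)"
    by (rule finite_subset[of _ "{0, 1}"]) (auto intro: bit_not_one_iff[THEN iffD1])
  then show "finite (vec_of_list ` {xs :: bit list. set xs \<subseteq> UNIV \<and> length xs = N})"
    by (intro finite_imageI finite_lists_length_eq)
qed

text \<open>Adding the unit vector at a position where \<open>w\<close> is 1 permutes the space and
  flips every sign.\<close>

lemma sum_bit_sign_scalar_prod:
  fixes w :: "bit vec"
  assumes w: "w \<in> carrier_vec N" and nz: "w \<noteq> 0\<^sub>v N"
  shows "(\<Sum>u\<in>carrier_vec N. bit_sign (u \<bullet> w)) = 0"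
proof -
  obtain j where j: "j < N" "w $ j \<noteq> 0"
    using w nz by (metis carrier_vecD eq_vecI index_zero_vec)
  let ?t = "\<lambda>u. u + unit_vec N j"
  have tt: "?t (?t u) = u" if "u \<in> carrier_vec N" for u :: "bit vec"
    using that by (intro eq_vecI) auto
  have "bij_betw ?t (carrier_vec N :: bit vec set) (carrier_vec N)"
    by (rule bij_betw_byWitness[where f' = ?t]) (auto simp: tt)
  moreover have "?t u \<bullet> w = u \<bullet> w + 1" if "u \<in> carrier_vec N" for u
    using that j w by (simp add: add_scalar_prod_distrib[of _ N])
  ultimately show ?thesis by (rule sum_bit_sign_eq_0)
qed

lemma dual_code_subset_codewords:
  assumes card: "CARD('a :: finite_field) = 2 ^ r" and r: "1 \<le> r"
  shows "dual_code (length gs) (trace_code gs) \<subseteq> range (codeword r (gs :: 'a mat list))"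
proof (rule subsetI, rule ccontr)
  fix v
  assume v: "v \<in> dual_code (length gs) (trace_code gs)"
    and no: "v \<notin> range (codeword r gs)"
  define N where "N = length gs"
  define U where "U = (carrier_vec N :: bit vec set)"
  define \<phi> :: "bit vec \<Rightarrow> 'a" where
    "\<phi> u = (\<Sum>j<length gs. of_bit (u $ j) * mat_trace (gs ! j))" for u
  have vN: "v \<in> carrier_vec N" and orth: "u \<in> trace_code gs \<Longrightarrow> u \<bullet> v = 0" for u
    using v by (auto simp: dual_code_def N_def)
  have fin: "finite U" by (simp add: U_def finite_carrier_vec_bit)
  \<comment> \<open>The product of signs is the sign of \<open>u\<close> paired with
    \<open>v + c(a)\<close>, which is nonzero since \<open>v\<close> differs from
    \<open>c(a)\<close> and the characteristic is two.\<close>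
  have "(\<Sum>u\<in>U. bit_sign (u \<bullet> v) * bit_sign (abs_trace r (a * \<phi> u))) = 0" for a
  proof -
    have c: "codeword r gs a \<in> carrier_vec N" by (simp add: N_def codeword_carrier)
    have "v + codeword r gs a \<noteq> 0\<^sub>v N"
    proof
      assume eq: "v + codeword r gs a = 0\<^sub>v N"
      have "v = codeword r gs a"
      proof (rule eq_vecI)
        fix j assume "j < dim_vec (codeword r gs a)"
        then have "v $ j + codeword r gs a $ j = 0"
          using arg_cong[OF eq, of "\<lambda>w. w $ j"] c by auto
        then show "v $ j = codeword r gs a $ j"
          by (cases "v $ j"; cases "codeword r gs a $ j") auto
      qed (use vN c in auto)
      with no show False by auto
    qed
    then have "(\<Sum>u\<in>U. bit_sign (u \<bullet> (v + codeword r gs a))) = 0"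
      unfolding U_def using vN c by (intro sum_bit_sign_scalar_prod) auto
    moreover have "bit_sign (u \<bullet> (v + codeword r gs a)) =
        bit_sign (u \<bullet> v) * bit_sign (abs_trace r (a * \<phi> u))" if "u \<in> U" for u
      using that unfolding U_def
      by (simp only: scalar_prod_add_distrib[OF _ vN c] bit_sign_add \<phi>_def
          scalar_prod_codeword[OF card])
    ultimately show ?thesis by simp
  qed
  then have "0 = (\<Sum>a\<in>UNIV. \<Sum>u\<in>U. bit_sign (u \<bullet> v) * bit_sign (abs_trace r (a * \<phi> u)))"
    by simp
  also have "\<dots> = (\<Sum>u\<in>U. bit_sign (u \<bullet> v) * (\<Sum>a\<in>UNIV. bit_sign (abs_trace r (a * \<phi> u))))"
    by (subst sum.swap) (simp add: sum_distrib_left)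
  \<comment> \<open>Only the \<open>u\<close> with \<open>\<phi> u = 0\<close> survive. These lie in
    the code, so they are orthogonal to \<open>v\<close> and their sign is 1.\<close>
  also have "\<dots> = (\<Sum>u\<in>U. if \<phi> u = 0 then 2 ^ r else 0)"
    unfolding sum_bit_sign_abs_trace[OF card r]
    by (intro sum.cong refl) (auto simp: U_def N_def \<phi>_def trace_code_def orth bit_sign_def)
  \<comment> \<open>The zero word alone already contributes q, against a total of 0.\<close>
  also have "\<dots> \<ge> (\<Sum>u\<in>{0\<^sub>v N}. if \<phi> u = 0 then 2 ^ r else 0)"
    by (rule sum_mono2[OF fin]) (auto simp: U_def)
  also have "(\<Sum>u\<in>{0\<^sub>v N}. if \<phi> u = 0 then 2 ^ r else (0 :: int)) = 2 ^ r"
    by (simp add: \<phi>_def N_def)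
  finally show False by simp
qed

lemma F2_linear_iso_codeword:
  fixes gs :: "'a :: finite_field mat list"
  assumes card: "CARD('a) = 2 ^ r" and r: "1 \<le> r"
    and inj: "\<And>a. (\<And>g. g \<in> set gs \<Longrightarrow> abs_trace r (a * mat_trace g) = 0) \<Longrightarrow> a = 0"
  shows "F2_linear_iso (codeword r gs) (dual_code (length gs) (trace_code gs))"
  unfolding F2_linear_iso_def
proof (intro conjI allI)
  show add: "codeword r gs (a + b) = codeword r gs a + codeword r gs b" for a b
    by (rule eq_vecI) (simp_all add: codeword_def distrib_right abs_trace_add[OF card])
  show "codeword r gs (of_bit k * a) = k \<cdot>\<^sub>v codeword r gs a" for k a
    by (rule eq_vecI)
      (simp_all only: codeword_def index_vec index_smult_vec dim_vec mult.assoc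
        abs_trace_of_bit_mult[OF card])
  have "inj (codeword r gs)"
  proof (rule injI)
    fix a b
    assume eq: "codeword r gs a = codeword r gs b"
    \<comment> \<open>In characteristic two this sum is the difference of \<open>a\<close> and
      \<open>b\<close>, so a trivial kernel suffices.\<close>
    have "a + b = 0"
    proof (rule inj)
      fix g assume "g \<in> set gs"
      then obtain j where j: "j < length gs" "g = gs ! j" by (auto simp: in_set_conv_nth)
      have "codeword r gs (a + b) $ j = 0"
        unfolding add eq using j codeword_carrier[of r gs b] by auto
      then show "abs_trace r ((a + b) * mat_trace g) = 0"
        using j by (simp add: codeword_def)
    qed
    then show "a = b"
      using char2_double[OF card, of b] by (metis add_right_cancel)
  qed
  then show "bij_betw (codeword r gs) UNIV (dual_code (length gs) (trace_code gs))"
    using dual_code_subset_codewords[OF card r, of gs] codeword_in_dual_code[OF card]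
    by (auto simp: bij_betw_def)
qed

section \<open>Group elements with prescribed traces\<close>

lemma mat_in_GL:
  fixes A B :: "'a :: field mat"
  assumes "A \<in> carrier_mat m m" "B \<in> carrier_mat m m" "A * B = 1\<^sub>m m" "B * A = 1\<^sub>m m"
  shows "A \<in> carrier (GL m)"
  using assms by (auto simp: GL_def units_of_def Units_def ring_mat_def)

lemma sum_lessThan_2: "(\<Sum>i<2::nat. f i) = f 0 + (f 1 :: 'b :: comm_monoid_add)"
  by (simp add: numeral_2_eq_2)

lemma sum_lessThan_4: "(\<Sum>i<4::nat. f i) = f 0 + f 1 + f 2 + (f 3 :: 'b :: comm_monoid_add)"
  by (simp add: eval_nat_numeral)

text \<open>The witness is diagonal: its reciprocal entries cancel in the product of the two
  coordinates, and its off-diagonal blocks vanish.\<close>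

lemma SO_plus_1_trace:
  fixes t :: "'a :: field"
  assumes t: "t \<noteq> 0"
  shows "\<exists>g \<in> SO_plus 1. mat_trace g = t + inverse t"
proof
  define g where "g = mat_of_rows_list 2 [[t, 0], [0, inverse t]]"
  define h where "h = mat_of_rows_list 2 [[inverse t, 0], [0, t]]"
  have carrier: "g \<in> carrier_mat 2 2" "h \<in> carrier_mat 2 2"
    by (auto simp: g_def h_def mat_of_rows_list_def)
  have idx: "i < 2 \<Longrightarrow> i = 0 \<or> i = (1 :: nat)" for i by auto
  have "g * h = 1\<^sub>m 2" "h * g = 1\<^sub>m 2"
    using t by (auto intro!: eq_matI dest!: idx simp: g_def h_def mat_of_rows_list_def
        scalar_prod_def atLeast0LessThan sum_lessThan_2)
  with carrier have "g \<in> carrier (GL 2)" by (intro mat_in_GL)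
  moreover have "theta_plus 1 (g *\<^sub>v x) = theta_plus 1 x" if "x \<in> carrier_vec 2" for x
    using that t by (simp add: theta_plus_def g_def mat_of_rows_list_def
        scalar_prod_def atLeast0LessThan sum_lessThan_2)
  moreover have "delta_plus 1 g = 0"
    by (simp add: delta_plus_def split_block_def g_def mat_of_rows_list_def mat_trace_def
        scalar_prod_def)
  ultimately show "g \<in> SO_plus 1" by (simp add: SO_plus_def O_plus_def)
  show "mat_trace g = t + inverse t"
    by (simp add: g_def mat_trace_def mat_of_rows_list_def sum_lessThan_2)
qed

text \<open>
  Identify \<open>x\<close> with the \<open>2 \<times> 2\<close> matrix \<open>X = [[x\<^sub>0, x\<^sub>1], [x\<^sub>3, x\<^sub>2]]\<close>, so that \<open>\<theta>\<^sup>+\<close> becomes the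
  determinant. The witness is \<open>X \<mapsto> P X Q\<close> with \<open>P = [[s, 1], [1, 0]]\<close> and
  \<open>Q = [[1, 1], [1, 0]]\<close>, whose trace is \<open>Tr P \<cdot> Tr Q = s\<close>.
\<close>

lemma SO_plus_2_trace:
  fixes s :: "'a :: finite_field"
  assumes card: "CARD('a) = 2 ^ r"
  shows "\<exists>g \<in> SO_plus 2. mat_trace g = s"
proof
  define g where "g = mat_of_rows_list 4 [[s, s, 1, 1], [s, 0, 0, 1], [1, 0, 0, 0], [1, 1, 0, 0]]"
  \<comment> \<open>The matrix of the inverse map, which multiplies by the inverses of
    \<open>P\<close> and \<open>Q\<close>, with signs dropped.\<close>
  define h where "h = mat_of_rows_list 4 [[0, 0, 1, 0], [0, 0, 1, 1], [1, 1, s, s], [0, 1, s, 0]]"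
  have dbl: "y + y = 0" "y + (y + z) = z" for y z :: 'a
    using char2_double[OF card, of y] by (simp_all add: add.assoc[symmetric])
  have carrier: "g \<in> carrier_mat 4 4" "h \<in> carrier_mat 4 4"
    by (auto simp: g_def h_def mat_of_rows_list_def)
  have idx: "i < 4 \<Longrightarrow> i = 0 \<or> i = 1 \<or> i = 2 \<or> i = (3 :: nat)" for i by auto
  have "g * h = 1\<^sub>m 4" "h * g = 1\<^sub>m 4"
    by (auto intro!: eq_matI dest!: idx simp: g_def h_def mat_of_rows_list_def
        scalar_prod_def atLeast0LessThan sum_lessThan_4 dbl)
  with carrier have "g \<in> carrier (GL 4)" by (intro mat_in_GL)
  moreover have "theta_plus 2 (g *\<^sub>v x) = theta_plus 2 x" if "x \<in> carrier_vec 4" for x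
    using that
    by (simp add: theta_plus_def g_def mat_of_rows_list_def scalar_prod_def
        atLeast0LessThan sum_lessThan_2 sum_lessThan_4 dbl algebra_simps)
      (simp add: numeral_2_eq_2 numeral_3_eq_3)
  \<comment> \<open>The two off-diagonal blocks share exactly two entries equal to 1, and
    \<open>1 + 1 = 0\<close>.\<close>
  moreover have "delta_plus 2 g = 0"
    by (simp add: delta_plus_def split_block_def g_def mat_of_rows_list_def mat_trace_def
        scalar_prod_def atLeast0LessThan sum_lessThan_2 dbl)
  ultimately show "g \<in> SO_plus 2" by (simp add: SO_plus_def O_plus_def)
  show "mat_trace g = s"
    by (simp add: g_def mat_trace_def mat_of_rows_list_def sum_lessThan_4)
qed

theorem theorem12:
  fixes r :: nat
  assumes "1 \<le> r" and "CARD('a::finite_field) = 2 ^ r"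
  shows
    "(\<forall>m (G :: 'a mat set) gs a. subgroup G (GL m) \<longrightarrow> lists_elements gs G \<longrightarrow>
        codeword r gs a \<in> dual_code (length gs) (trace_code gs)) \<and>
     (3 \<le> r \<longrightarrow>
        (\<forall>gs :: 'a mat list. lists_elements gs (SO_plus 1) \<longrightarrow>
           F2_linear_iso (codeword r gs) (dual_code (length gs) (trace_code gs))) \<and>
        (\<forall>gs :: 'a mat list. lists_elements gs (O_plus 1) \<longrightarrow>
           F2_linear_iso (codeword r gs) (dual_code (length gs) (trace_code gs)))) \<and>
     (\<forall>gs :: 'a mat list. lists_elements gs (SO_plus 2) \<longrightarrow>
        F2_linear_iso (codeword r gs) (dual_code (length gs) (trace_code gs)))"
proof -
  note r = assms(1) and card = assms(2)
  \<comment> \<open>Further matrices in the list only add conditions on \<open>a\<close>, so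
    containing \<open>SO_plus 1\<close> is enough; this treats both groups at once.\<close>
  have iso1: "F2_linear_iso (codeword r gs) (dual_code (length gs) (trace_code gs))"
    if "3 \<le> r" "SO_plus 1 \<subseteq> set gs" for gs :: "'a mat list"
  proof (rule F2_linear_iso_codeword[OF card r])
    fix a :: 'a
    assume zero: "\<And>g. g \<in> set gs \<Longrightarrow> abs_trace r (a * mat_trace g) = 0"
    show "a = 0"
    proof (rule abs_trace_inverse_nondegenerate[OF card that(1)])
      fix t :: 'a assume "t \<noteq> 0"
      from SO_plus_1_trace[OF this] that(2) zero
      show "abs_trace r (a * (t + inverse t)) = 0" by (metis subsetD)
    qed
  qed
  have iso2: "F2_linear_iso (codeword r gs) (dual_code (length gs) (trace_code gs))"
    if "SO_plus 2 \<subseteq> set gs" for gs :: "'a mat list"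
  proof (rule F2_linear_iso_codeword[OF card r])
    fix a :: 'a
    assume zero: "\<And>g. g \<in> set gs \<Longrightarrow> abs_trace r (a * mat_trace g) = 0"
    show "a = 0"
    proof (rule abs_trace_nondegenerate[OF card r])
      fix x :: 'a
      from SO_plus_2_trace[OF card, of x] that zero
      show "abs_trace r (a * x) = 0" by (metis subsetD)
    qed
  qed
  have "SO_plus 1 \<subseteq> (O_plus 1 :: 'a mat set)" by (auto simp: SO_plus_def)
  then show ?thesis
    using codeword_in_dual_code[OF card] iso1 iso2 by (auto simp: lists_elements_def)
qed

end
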